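(* Let $a<b$ be real numbers, let $1<p<\infty$, and let $q$ satisfy $\frac1p+\frac1q=1$. Let $f:[a,b]\times\mathbb{R}\to\mathbb{R}$ satisfy the Carathéodory conditions, let $k:[a,b]\times[a,b]\to\mathbb{R}$, and let $g$ be a function on $[a,b]\times\mathbb{R}$. Assume: (A1) There are a non-negative function $h_1\in L^p([a,b])$ and a constant $b_1\ge 0$ such that $|f(t,x)|\le h_1(t)+b_1|x|^{q/p}$ for a.e. $t\in[a,b]$ and all $x\in\mathbb{R}$. (A2) For all $t\in[a,b]$, $k(t,\cdot)$ is measurable and belongs to $L^q([a,b])$, and $\left(\int_a^b|k(t,s)|^q\,ds\right)^{1/q}\le M_1(t)$ for any $t\in[a,b]$, where $M_1$ is a non-negative function in $L^p([a,b])$. (A3) $g$ is a map from $[a,b]\times\mathbb{R}$ into $[a,b]$ satisfying the Carathéodory conditions and such that $|g(s,z)|\le a_0(s)+b_0|z|$ for $s\in[a,b]$, $z\in\mathbb{R}$, where $a_0$ is a non-negative function in $L^p([a,b])$ and $b_0\ge0$ is a constant. (H1) There is $M>0$ such that $|f(t,x_1)-f(t,x_2)|\le M|x_1-x_2|$ for any $t\in[a,b]$ and $x_1,x_2\in\mathbb{R}$. (H2) There is $L>0$ such that $|g(s,z_1)-g(s,z_2)|\le L|z_1-z_2|$ for any $s\in[a,b]$ and $z_1,z_2\in\mathbb{R}$. Put $C=ML$ and $N=\left(\int_a^b C^p[M_1(s)]^p\,ds\right)^{1/p}$, and assume $N<1$. Let $$(Ay)(t)=f\left(t,\int_a^b k(t,s)\,g(s,y(s))\,ds\right),\qquad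 t\in[a,b],$$ and let the sequence $(y_n)$ be generated by the successive approximation method $y_0=0$, $y_{n+1}=Ay_n$ for $n=0,1,2,\dots$. Then $$\|y^\ast-y_n\|_p\le\frac{N^n}{1-N}\,\|y_1\|_p,$$ where $y^\ast\in L^p([a,b])$ is the exact solution of the equation $y(t)=f\left(t,\int_a^b k(t,s)\,g(s,y(s))\,ds\right)$, $t\in[a,b]$.
   Context: A function $\varphi:[a,b]\times\mathbb{R}\to\mathbb{R}$ satisfies the Carathéodory conditions if: (i) $\varphi(t,x)$ is continuous in $x$ for each fixed $t$; (ii) $\varphi(t,x)$ is measurable in $t$ for each fixed $x$; (iii) there is a non-negative Lebesgue-integrable function $m:[a,b]\to\mathbb{R}$ such that $|\varphi(t,x)|\le m(t)$ for all $(t,x)\in[a,b]\times\mathbb{R}$. Functions are real-valued, $L^p([a,b])$ is taken with respect to Lebesgue measure, and $\|\cdot\|_p$ is its usual norm. A solution in $L^p([a,b])$ is a $y\in L^p([a,b])$ satisfying the equation (as an identity of elements of $L^p([a,b])$).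
   Formalization: The iterates y_n are additionally assumed Lebesgue measurable on [a,b]: since k(t,s) is only assumed measurable in s for each t, Ay may be non-measurable, and then the norms are undefined and no L^p solution need exist. *)

theory Defs
  imports "HOL-Analysis.Analysis"
begin

definition in_Lp :: "real \<Rightarrow> real set \<Rightarrow> (real \<Rightarrow> real) \<Rightarrow> bool" where
  "in_Lp p S u \<longleftrightarrow>
     u \<in> borel_measurable (lebesgue_on S) \<and>
     integrable (lebesgue_on S) (\<lambda>t. \<bar>u t\<bar> powr p)"

definition Lp_norm :: "real \<Rightarrow> real set \<Rightarrow> (real \<Rightarrow> real) \<Rightarrow> real" where
  "Lp_norm p S u = (LINT t|lebesgue_on S. \<bar>u t\<bar> powr p) powr (1 / p)"

definition caratheodory :: "real \<Rightarrow> real \<Rightarrow> (real \<Rightarrow> real \<Rightarrow> real) \<Rightarrow> bool" where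
  "caratheodory a b \<phi> \<longleftrightarrow>
     (\<forall>t\<in>{a..b}. continuous_on UNIV (\<lambda>x. \<phi> t x)) \<and>
     (\<forall>x. (\<lambda>t. \<phi> t x) \<in> borel_measurable (lebesgue_on {a..b})) \<and>
     (\<exists>m. integrable (lebesgue_on {a..b}) m \<and> (\<forall>t\<in>{a..b}. 0 \<le> m t) \<and>
          (\<forall>t\<in>{a..b}. \<forall>x. \<bar>\<phi> t x\<bar> \<le> m t))"

definition integral_op ::
  "real \<Rightarrow> real \<Rightarrow> (real \<Rightarrow> real \<Rightarrow> real) \<Rightarrow> (real \<Rightarrow> real \<Rightarrow> real) \<Rightarrow> (real \<Rightarrow> real \<Rightarrow> real) \<Rightarrow>
   (real \<Rightarrow> real) \<Rightarrow> real \<Rightarrow> real" where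
  "integral_op a b f k g y t = f t (LINT s|lebesgue_on {a..b}. k t s * g s (y s))"

text \<open>Elements of \<open>L\<^sup>p\<close> are represented by functions, so identities between them hold
  almost everywhere.\<close>

definition Lp_solution ::
  "real \<Rightarrow> real \<Rightarrow> real \<Rightarrow> (real \<Rightarrow> real \<Rightarrow> real) \<Rightarrow> (real \<Rightarrow> real \<Rightarrow> real) \<Rightarrow> (real \<Rightarrow> real \<Rightarrow> real) \<Rightarrow>
   (real \<Rightarrow> real) \<Rightarrow> bool" where
  "Lp_solution p a b f k g y \<longleftrightarrow>
     in_Lp p {a..b} y \<and>
     (AE t in lebesgue_on {a..b}. y t = integral_op a b f k g y t)"

text \<open>Measurability of the iterates has to be required: a kernel \<open>k\<close> that is measurable only in
  its second argument may turn a measurable \<open>y\<close> into a non-measurable \<open>integral_op a b f k g y\<close>.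
  Integrability of \<open>\<bar>y n\<bar>\<^sup>p\<close> is not part of the definition.\<close>

definition successive_approximations ::
  "real \<Rightarrow> real \<Rightarrow> (real \<Rightarrow> real \<Rightarrow> real) \<Rightarrow> (real \<Rightarrow> real \<Rightarrow> real) \<Rightarrow> (real \<Rightarrow> real \<Rightarrow> real) \<Rightarrow>
   (nat \<Rightarrow> real \<Rightarrow> real) \<Rightarrow> bool" where
  "successive_approximations a b f k g y \<longleftrightarrow>
     (\<forall>n. y n \<in> borel_measurable (lebesgue_on {a..b})) \<and>
     (AE t in lebesgue_on {a..b}. y 0 t = 0) \<and>
     (\<forall>n. AE t in lebesgue_on {a..b}. y (Suc n) t = integral_op a b f k g (y n) t)"

end

theory Submission imports Defs begin

text \<open>The operator \<open>A\<close> is a contraction of \<open>L\<^sup>p\<close>, in a pointwise form. For \<open>u\<close> and \<open>v\<close> in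
  \<open>L\<^sup>p\<close> and every \<open>t\<close>, the Lipschitz conditions on \<open>f\<close> and \<open>g\<close> and Hoelder's inequality for
  \<open>k t\<close> and \<open>u - v\<close> give \<open>\<bar>A u t - A v t\<bar> \<le> C * M1 t * \<parallel>u - v\<parallel>\<close>
  (\<open>integral_op_Lipschitz\<close>). The number \<open>N\<close> is exactly the \<open>L\<^sup>p\<close> norm of \<open>C * M1\<close>, so taking
  norms shows that \<open>N\<close> is a contraction constant.

  Applied to consecutive iterates, the norm estimate gives \<open>\<parallel>y (n + 1) - y n\<parallel> \<le> N ^ n * \<parallel>y 1\<parallel>\<close>;
  put back into the pointwise estimate, this makes the increments of \<open>y n t\<close> geometrically small
  for almost every \<open>t\<close>. Hence the iterates converge almost everywhere. For \<open>n \<ge> 1\<close>,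
  summing the tails bounds the distance of the limit to \<open>y n\<close> at \<open>t\<close> by a multiple of \<open>M1 t\<close>, and the
  norm of this multiple is the asserted error; the case \<open>n = 0\<close> follows by Minkowski's inequality
  from \<open>n = 1\<close>. The same pointwise estimate shows that the limit is a solution and that any
  two solutions agree almost everywhere (\<open>pointwise_contraction_fixed_point\<close>).

  What remains is that each iterate lies in \<open>L\<^sup>p\<close>. Since \<open>g\<close> takes values in \<open>[a, b]\<close>, the integral
  in \<open>A\<close> is at most a constant times \<open>M1 t\<close>, and the Lipschitz condition on \<open>f\<close> then dominates
  \<open>A u\<close> by \<open>\<bar>f t 0\<bar>\<close> plus a multiple of \<open>M1\<close> (\<open>integral_op_bound\<close>); the growth condition at
  \<open>x = 0\<close> bounds the first summand by \<open>h1\<close>.\<close>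

section \<open>The spaces \<open>L\<^sup>p\<close>\<close>

lemma Lp_norm_nonneg: "0 \<le> Lp_norm p S u"
  by (simp add: Lp_norm_def)

lemma integral_abs_powr_eq_Lp_norm_powr:
  assumes "0 < p"
  shows "(LINT t|lebesgue_on S. \<bar>u t\<bar> powr p) = Lp_norm p S u powr p"
  using assms by (simp add: Lp_norm_def powr_powr)

lemma Lp_norm_cong_AE:
  assumes "u \<in> borel_measurable (lebesgue_on S)" "v \<in> borel_measurable (lebesgue_on S)"
    and "AE t in lebesgue_on S. u t = v t"
  shows "Lp_norm p S u = Lp_norm p S v"
proof -
  have "(LINT t|lebesgue_on S. \<bar>u t\<bar> powr p) = (LINT t|lebesgue_on S. \<bar>v t\<bar> powr p)"
    using assms by (intro integral_cong_AE) auto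
  then show ?thesis by (simp add: Lp_norm_def)
qed

lemma in_Lp_cmult:
  assumes "in_Lp p S u"
  shows "in_Lp p S (\<lambda>t. c * u t)"
  using assms by (auto simp: in_Lp_def abs_mult powr_mult)

lemma Lp_norm_cmult:
  assumes "0 < p"
  shows "Lp_norm p S (\<lambda>t. c * u t) = \<bar>c\<bar> * Lp_norm p S u"
  using assms by (simp add: Lp_norm_def abs_mult powr_mult powr_powr)

lemma in_Lp_uminus: "in_Lp p S u \<Longrightarrow> in_Lp p S (\<lambda>t. - u t)"
  using in_Lp_cmult[of p S u "-1"] by simp

lemma in_Lp_dominated:
  assumes "0 \<le> p" "in_Lp p S v" "u \<in> borel_measurable (lebesgue_on S)"
    and "AE t in lebesgue_on S. \<bar>u t\<bar> \<le> \<bar>v t\<bar>"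
  shows "in_Lp p S u"
proof -
  have "integrable (lebesgue_on S) (\<lambda>t. \<bar>u t\<bar> powr p)"
  proof (rule Bochner_Integration.integrable_bound)
    show "integrable (lebesgue_on S) (\<lambda>t. \<bar>v t\<bar> powr p)"
      using assms by (simp add: in_Lp_def)
    show "(\<lambda>t. \<bar>u t\<bar> powr p) \<in> borel_measurable (lebesgue_on S)"
      using assms by simp
    show "AE t in lebesgue_on S. norm (\<bar>u t\<bar> powr p) \<le> norm (\<bar>v t\<bar> powr p)"
      using assms(4) by eventually_elim (use assms(1) in \<open>auto intro: powr_mono2\<close>)
  qed
  then show ?thesis using assms by (simp add: in_Lp_def)
qed

lemma Lp_norm_mono_AE:
  assumes "0 < p" "in_Lp p S v" "u \<in> borel_measurable (lebesgue_on S)"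
    and "AE t in lebesgue_on S. \<bar>u t\<bar> \<le> \<bar>v t\<bar>"
  shows "Lp_norm p S u \<le> Lp_norm p S v"
proof -
  have "in_Lp p S u" using assms by (intro in_Lp_dominated[of p S v u]) auto
  then have "(LINT t|lebesgue_on S. \<bar>u t\<bar> powr p) \<le> (LINT t|lebesgue_on S. \<bar>v t\<bar> powr p)"
  proof (intro integral_mono_AE)
    show "AE t in lebesgue_on S. \<bar>u t\<bar> powr p \<le> \<bar>v t\<bar> powr p"
      using assms(4) by eventually_elim (use assms(1) in \<open>auto intro: powr_mono2\<close>)
  qed (use assms in \<open>auto simp: in_Lp_def\<close>)
  then show ?thesis
    unfolding Lp_norm_def using assms(1) by (intro powr_mono2) auto
qed

lemma Lp_norm_eq_0_imp_AE_0:
  assumes "0 < p" "in_Lp p S u" "Lp_norm p S u = 0"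
  shows "AE t in lebesgue_on S. u t = 0"
proof -
  have "(LINT t|lebesgue_on S. \<bar>u t\<bar> powr p) = 0"
    using assms by (simp add: integral_abs_powr_eq_Lp_norm_powr)
  then have "AE t in lebesgue_on S. \<bar>u t\<bar> powr p = 0"
    using assms by (subst (asm) integral_nonneg_eq_0_iff_AE) (auto simp: in_Lp_def)
  then show ?thesis by eventually_elim simp
qed

lemma in_Lp_add:
  assumes p: "0 < p" and u: "in_Lp p S u" and v: "in_Lp p S v"
  shows "in_Lp p S (\<lambda>t. u t + v t)"
proof -
  have "integrable (lebesgue_on S) (\<lambda>t. \<bar>u t + v t\<bar> powr p)"
  proof (rule Bochner_Integration.integrable_bound)
    show "integrable (lebesgue_on S) (\<lambda>t. \<bar>2 * u t\<bar> powr p + \<bar>2 * v t\<bar> powr p)"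
      using in_Lp_cmult[OF u, of 2] in_Lp_cmult[OF v, of 2] by (simp add: in_Lp_def)
    show "(\<lambda>t. \<bar>u t + v t\<bar> powr p) \<in> borel_measurable (lebesgue_on S)"
      using u v by (auto simp: in_Lp_def)
    have "\<bar>x + y\<bar> powr p \<le> \<bar>2 * x\<bar> powr p + \<bar>2 * y\<bar> powr p" for x y :: real
    proof (cases "\<bar>x\<bar> \<le> \<bar>y\<bar>")
      case True
      then have "\<bar>x + y\<bar> powr p \<le> \<bar>2 * y\<bar> powr p" using p by (intro powr_mono2) auto
      then show ?thesis by (smt (verit) powr_ge_zero)
    next
      case False
      then have "\<bar>x + y\<bar> powr p \<le> \<bar>2 * x\<bar> powr p" using p by (intro powr_mono2) auto
      then show ?thesis by (smt (verit) powr_ge_zero)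
    qed
    then show "AE t in lebesgue_on S. norm (\<bar>u t + v t\<bar> powr p)
        \<le> norm (\<bar>2 * u t\<bar> powr p + \<bar>2 * v t\<bar> powr p)"
      by simp
  qed
  then show ?thesis using u v by (auto simp: in_Lp_def)
qed

lemma in_Lp_diff:
  assumes "0 < p" "in_Lp p S u" "in_Lp p S v"
  shows "in_Lp p S (\<lambda>t. u t - v t)"
  using in_Lp_add[OF assms(1,2) in_Lp_uminus[OF assms(3)]] by simp

lemma in_Lp_const:
  assumes "S \<in> lmeasurable"
  shows "in_Lp p S (\<lambda>t. c)"
proof -
  interpret finite_measure "lebesgue_on S"
    using assms by (rule finite_measure_lebesgue_on)
  show ?thesis by (simp add: in_Lp_def)
qed

text \<open>Convexity of \<open>x\<^sup>p\<close> at \<open>a + b = l (a / l) + (1 - l) (b / (1 - l))\<close>. After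
  integration, \<open>l\<close> is chosen as the share of one norm in the sum of both, which gives
  Minkowski's inequality.\<close>

lemma powr_add_le_weighted:
  fixes a b l p :: real
  assumes "1 \<le> p" "0 < l" "l < 1" "0 \<le> a" "0 \<le> b"
  shows "(a + b) powr p \<le> l powr (1 - p) * a powr p + (1 - l) powr (1 - p) * b powr p"
proof -
  have "1 \<le> w powr (1 - p)" if "0 < w" "w < 1" for w :: real
    using powr_mono'[of "1 - p" 0 w] that assms by simp
  then have one_le: "x \<le> w powr (1 - p) * x" if "0 < w" "w < 1" "0 \<le> x" for w x :: real
    using that mult_right_mono[of 1 "w powr (1 - p)" x] by simp
  show ?thesis
  proof (cases "a = 0 \<or> b = 0")
    case True
    then show ?thesis
      using one_le[of l "a powr p"] one_le[of "1 - l" "b powr p"] assms by auto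
  next
    case False
    have "((1 - l) *\<^sub>R (b / (1 - l)) + l *\<^sub>R (a / l)) powr p
        \<le> (1 - l) * (b / (1 - l)) powr p + l * (a / l) powr p"
      using False assms by (intro convex_onD[OF powr_convex]) auto
    then show ?thesis
      using assms by (simp add: powr_divide powr_diff add.commute)
  qed
qed

theorem Minkowski_inequality:
  assumes p: "1 \<le> p" and u: "in_Lp p S u" and v: "in_Lp p S v"
  shows "Lp_norm p S (\<lambda>t. u t + v t) \<le> Lp_norm p S u + Lp_norm p S v"
proof -
  define U where "U = Lp_norm p S u"
  define V where "V = Lp_norm p S v"
  have uv: "in_Lp p S (\<lambda>t. u t + v t)" using in_Lp_add u v p by simp
  have meas: "u \<in> borel_measurable (lebesgue_on S)" "v \<in> borel_measurable (lebesgue_on S)"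
      "(\<lambda>t. u t + v t) \<in> borel_measurable (lebesgue_on S)"
    using u v uv by (simp_all add: in_Lp_def)
  have nonneg: "0 \<le> U" "0 \<le> V" by (simp_all add: U_def V_def Lp_norm_nonneg)
  consider "U = 0" | "V = 0" | "0 < U" "0 < V" using nonneg by linarith
  then show ?thesis
  proof cases
    case 1
    then have "AE t in lebesgue_on S. u t = 0"
      using Lp_norm_eq_0_imp_AE_0[of p S u] u p by (simp add: U_def)
    then have "Lp_norm p S (\<lambda>t. u t + v t) = Lp_norm p S v"
      using meas by (intro Lp_norm_cong_AE) auto
    then show ?thesis by (simp add: Lp_norm_nonneg)
  next
    case 2
    then have "AE t in lebesgue_on S. v t = 0"
      using Lp_norm_eq_0_imp_AE_0[of p S v] v p by (simp add: V_def)
    then have "Lp_norm p S (\<lambda>t. u t + v t) = Lp_norm p S u"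
      using meas by (intro Lp_norm_cong_AE) auto
    then show ?thesis by (simp add: Lp_norm_nonneg)
  next
    case 3
    define l where "l = U / (U + V)"
    have l: "0 < l" "l < 1" "1 - l = V / (U + V)"
      using 3 by (auto simp: l_def field_simps)
    \<comment> \<open>With this \<open>l\<close>, both weighted terms carry the factor \<open>(U + V) powr p\<close>, with shares that
      add up to 1.\<close>
    have share: "(W / (U + V)) powr (1 - p) * W powr p = W / (U + V) * (U + V) powr p"
      if "0 < W" for W
      using that 3 by (simp add: powr_divide powr_diff)
    have "(LINT t|lebesgue_on S. \<bar>u t + v t\<bar> powr p)
        \<le> (LINT t|lebesgue_on S. l powr (1 - p) * \<bar>u t\<bar> powr p
              + (1 - l) powr (1 - p) * \<bar>v t\<bar> powr p)"
    proof (rule integral_mono)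
      fix t
      have "\<bar>u t + v t\<bar> powr p \<le> (\<bar>u t\<bar> + \<bar>v t\<bar>) powr p"
        using p by (intro powr_mono2) auto
      also have "\<dots> \<le> l powr (1 - p) * \<bar>u t\<bar> powr p + (1 - l) powr (1 - p) * \<bar>v t\<bar> powr p"
        using p l by (intro powr_add_le_weighted) auto
      finally show "\<bar>u t + v t\<bar> powr p
          \<le> l powr (1 - p) * \<bar>u t\<bar> powr p + (1 - l) powr (1 - p) * \<bar>v t\<bar> powr p" .
    qed (use u v uv in \<open>auto simp: in_Lp_def\<close>)
    also have "\<dots> = l powr (1 - p) * U powr p + (1 - l) powr (1 - p) * V powr p"
      using u v p by (simp add: in_Lp_def integral_abs_powr_eq_Lp_norm_powr U_def V_def)
    also have "\<dots> = U / (U + V) * (U + V) powr p + V / (U + V) * (U + V) powr p"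
      unfolding l(3) using share[of U] share[of V] 3 by (simp add: l_def)
    also have "\<dots> = (U + V) powr p"
      using 3 by (simp flip: distrib_right add_divide_distrib)
    finally have "Lp_norm p S (\<lambda>t. u t + v t) powr p \<le> (U + V) powr p"
      using p by (simp add: integral_abs_powr_eq_Lp_norm_powr)
    then show ?thesis
      using p 3 unfolding U_def V_def
      by (smt (verit) powr_less_mono2 Lp_norm_nonneg)
  qed
qed

text \<open>Young's inequality for \<open>\<bar>u t\<bar>\<close> and \<open>\<bar>v t\<bar>\<close> already gives integrability of the product. For
  the sharp bound it is applied after dividing each function by its norm, so the case of a zero
  norm, where the product vanishes almost everywhere, is separate.\<close>

theorem Holder_inequality:
  assumes pq: "1 < p" "1 < q" "1 / p + 1 / q = 1"
    and u: "in_Lp p S u" and v: "in_Lp q S v"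
  shows "integrable (lebesgue_on S) (\<lambda>t. u t * v t)"
    and "(LINT t|lebesgue_on S. \<bar>u t * v t\<bar>) \<le> Lp_norm p S u * Lp_norm q S v"
proof -
  define U where "U = Lp_norm p S u"
  define V where "V = Lp_norm q S v"
  have nonneg: "0 \<le> U" "0 \<le> V" by (simp_all add: U_def V_def Lp_norm_nonneg)
  have meas [measurable]:
      "u \<in> borel_measurable (lebesgue_on S)" "v \<in> borel_measurable (lebesgue_on S)"
    using u v by (simp_all add: in_Lp_def)
  have "integrable (lebesgue_on S) (\<lambda>t. \<bar>u t\<bar> powr p / p + \<bar>v t\<bar> powr q / q)"
    using u v by (simp add: in_Lp_def)
  then show integrable_uv: "integrable (lebesgue_on S) (\<lambda>t. u t * v t)"
  proof (rule Bochner_Integration.integrable_bound)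
    show "AE t in lebesgue_on S. norm (u t * v t) \<le> norm (\<bar>u t\<bar> powr p / p + \<bar>v t\<bar> powr q / q)"
      using Youngs_inequality[OF pq, of "\<bar>u _\<bar>" "\<bar>v _\<bar>"] pq by (simp add: abs_mult)
  qed simp
  consider "U = 0 \<or> V = 0" | "0 < U" "0 < V" using nonneg by linarith
  then show "(LINT t|lebesgue_on S. \<bar>u t * v t\<bar>) \<le> Lp_norm p S u * Lp_norm q S v"
  proof cases
    case 1
    then have "AE t in lebesgue_on S. u t * v t = 0"
    proof
      assume "U = 0"
      then have "AE t in lebesgue_on S. u t = 0"
        using Lp_norm_eq_0_imp_AE_0[of p S u] u pq by (simp add: U_def)
      then show ?thesis by eventually_elim simp
    next
      assume "V = 0"
      then have "AE t in lebesgue_on S. v t = 0"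
        using Lp_norm_eq_0_imp_AE_0[of q S v] v pq by (simp add: V_def)
      then show ?thesis by eventually_elim simp
    qed
    then have "(LINT t|lebesgue_on S. \<bar>u t * v t\<bar>) = (LINT t|lebesgue_on S. 0)"
      by (intro integral_cong_AE) auto
    then show ?thesis by (simp add: Lp_norm_nonneg)
  next
    case 2
    have "(LINT t|lebesgue_on S. \<bar>u t * v t\<bar>)
        \<le> (LINT t|lebesgue_on S. U * V * (\<bar>u t\<bar> powr p / (U powr p * p) + \<bar>v t\<bar> powr q / (V powr q * q)))"
    proof (rule integral_mono)
      fix t
      have "\<bar>u t\<bar> / U * (\<bar>v t\<bar> / V) \<le> (\<bar>u t\<bar> / U) powr p / p + (\<bar>v t\<bar> / V) powr q / q"
        using pq 2 by (intro Youngs_inequality) auto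
      then have "U * V * (\<bar>u t\<bar> / U * (\<bar>v t\<bar> / V))
          \<le> U * V * (\<bar>u t\<bar> powr p / (U powr p * p) + \<bar>v t\<bar> powr q / (V powr q * q))"
        using 2 by (intro mult_left_mono) (auto simp: powr_divide)
      then show "\<bar>u t * v t\<bar>
          \<le> U * V * (\<bar>u t\<bar> powr p / (U powr p * p) + \<bar>v t\<bar> powr q / (V powr q * q))"
        using 2 by (simp add: abs_mult)
    qed (use u v integrable_uv in \<open>auto simp: in_Lp_def\<close>)
    also have "\<dots> = U * V * (U powr p / (U powr p * p) + V powr q / (V powr q * q))"
      using u v pq by (simp add: in_Lp_def integral_abs_powr_eq_Lp_norm_powr U_def V_def)
    also have "\<dots> = U * V"
      using 2 pq by simp
    finally show ?thesis by (simp add: U_def V_def)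
  qed
qed

section \<open>Contractions with an \<open>L\<^sup>p\<close> modulus\<close>

lemma convergent_geometric_increments:
  fixes x :: "nat \<Rightarrow> real"
  assumes incr: "\<And>n. \<bar>x (Suc n) - x n\<bar> \<le> c * r ^ n" and r: "0 \<le> r" "r < 1"
  shows "convergent x" and "\<bar>lim x - x n\<bar> \<le> c * r ^ n / (1 - r)"
proof -
  have geom: "(\<lambda>i. c * r ^ (i + m)) sums (c * r ^ m / (1 - r))" for m
    using sums_mult[OF geometric_sums[of r], of "c * r ^ m"] r by (simp add: power_add mult_ac)
  have "summable (\<lambda>i. \<bar>x (Suc i) - x i\<bar>)"
    by (rule summable_comparison_test'[OF sums_summable[OF geom[of 0]], of 0]) (use incr in auto)
  then have abs_summable: "summable (\<lambda>i. \<bar>x (Suc (i + m)) - x (i + m)\<bar>)" for m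
    using summable_iff_shift[of "\<lambda>i. \<bar>x (Suc i) - x i\<bar>" m] by simp
  have "summable (\<lambda>i. x (Suc i) - x i)"
    by (rule summable_rabs_cancel) (use abs_summable[of 0] in simp)
  then have "convergent (\<lambda>n. x 0 + (\<Sum>i<n. x (Suc i) - x i))"
    by (intro convergent_add convergent_const) (simp add: summable_iff_convergent)
  then show conv: "convergent x"
    by (simp add: sum_lessThan_telescope)
  then have "x \<longlonglongrightarrow> lim x" by (simp add: convergent_LIMSEQ_iff)
  then have "(\<lambda>i. x (i + n)) \<longlonglongrightarrow> lim x" by (rule LIMSEQ_ignore_initial_segment)
  then have "(\<lambda>i. x (Suc i + n) - x (i + n)) sums (lim x - x (0 + n))"
    by (rule telescope_sums)
  then have "\<bar>lim x - x n\<bar> = \<bar>\<Sum>i. x (Suc (i + n)) - x (i + n)\<bar>"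
    by (simp add: sums_iff)
  also have "\<dots> \<le> (\<Sum>i. \<bar>x (Suc (i + n)) - x (i + n)\<bar>)"
    by (rule summable_rabs[OF abs_summable])
  also have "\<dots> \<le> (\<Sum>i. c * r ^ (i + n))"
    by (rule suminf_le[OF incr abs_summable sums_summable[OF geom]])
  also have "\<dots> = c * r ^ n / (1 - r)"
    using geom[of n] by (simp add: sums_iff)
  finally show "\<bar>lim x - x n\<bar> \<le> c * r ^ n / (1 - r)" .
qed

text \<open>The hypothesis on \<open>A\<close> is pointwise and therefore stronger than a Lipschitz estimate in the
  norm: almost every sequence \<open>y n t\<close> has increments bounded by a geometric sequence times \<open>K t\<close>,
  so the fixed point can be constructed as the pointwise limit. These bounds start only with the
  increment from \<open>y 1\<close> to \<open>y 2\<close>, since \<open>y 1 - y 0\<close> need not be bounded by a multiple of \<open>K\<close>; the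
  estimate for \<open>n = 0\<close> comes from the one for \<open>n = 1\<close> and Minkowski's inequality.\<close>

theorem pointwise_contraction_fixed_point:
  fixes A :: "(real \<Rightarrow> real) \<Rightarrow> real \<Rightarrow> real" and K :: "real \<Rightarrow> real"
  assumes p: "1 \<le> p"
    and K: "in_Lp p S K" "\<And>t. t \<in> S \<Longrightarrow> 0 \<le> K t" "Lp_norm p S K < 1"
    and A: "\<And>u v t. in_Lp p S u \<Longrightarrow> in_Lp p S v \<Longrightarrow> t \<in> S \<Longrightarrow>
      \<bar>A u t - A v t\<bar> \<le> K t * Lp_norm p S (\<lambda>s. u s - v s)"
    and y: "\<And>n. in_Lp p S (y n)" "AE t in lebesgue_on S. y 0 t = 0"
      "\<And>n. AE t in lebesgue_on S. y (Suc n) t = A (y n) t"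
  obtains ystar where "in_Lp p S ystar"
    and "AE t in lebesgue_on S. ystar t = A ystar t"
    and "\<And>z. in_Lp p S z \<Longrightarrow> AE t in lebesgue_on S. z t = A z t \<Longrightarrow>
      AE t in lebesgue_on S. z t = ystar t"
    and "\<And>n. Lp_norm p S (\<lambda>t. ystar t - y n t)
      \<le> Lp_norm p S K ^ n / (1 - Lp_norm p S K) * Lp_norm p S (y 1)"
proof -
  define N where "N = Lp_norm p S K"
  define D where "D = Lp_norm p S (y 1)"
  define ystar where "ystar t = lim (\<lambda>n. y n t)" for t
  have p0: "0 < p" using p by simp
  have N: "0 \<le> N" "N < 1" using K Lp_norm_nonneg by (auto simp: N_def)
  have D: "0 \<le> D" by (simp add: D_def Lp_norm_nonneg)
  have meas_y [measurable]: "y n \<in> borel_measurable (lebesgue_on S)" for n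
    using y(1) by (simp add: in_Lp_def)
  have meas_ystar [measurable]: "ystar \<in> borel_measurable (lebesgue_on S)"
    unfolding ystar_def by measurable
  have AE_S: "AE t in lebesgue_on S. t \<in> S" by (intro AE_I2) simp
  \<comment> \<open>Passes from a pointwise bound by a multiple of \<open>K\<close> to norms; each use gains a factor \<open>N\<close>.\<close>
  have Lp_le_K: "in_Lp p S w \<and> Lp_norm p S w \<le> c * N"
    if "w \<in> borel_measurable (lebesgue_on S)" "0 \<le> c"
      "AE t in lebesgue_on S. \<bar>w t\<bar> \<le> K t * c" for w c
  proof -
    have "AE t in lebesgue_on S. \<bar>w t\<bar> \<le> \<bar>c * K t\<bar>"
      using that(3) by eventually_elim (simp add: mult.commute)
    then show ?thesis
      using in_Lp_dominated[of p S "\<lambda>t. c * K t" w] Lp_norm_mono_AE[of p S "\<lambda>t. c * K t" w]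
        that(1,2) p0 in_Lp_cmult[OF K(1), of c] Lp_norm_cmult[OF p0, of S c K]
      by (simp add: N_def)
  qed
  have iterates: "AE t in lebesgue_on S. t \<in> S \<and> (\<forall>n. y (Suc n) t = A (y n) t)"
    using y(3) AE_S by (simp add: AE_all_countable)
  have increment_norm: "Lp_norm p S (\<lambda>t. y (Suc n) t - y n t) \<le> N ^ n * D" for n
  proof (induction n)
    case 0
    have "Lp_norm p S (\<lambda>t. y (Suc 0) t - y 0 t) = D"
      unfolding D_def using y(2) by (intro Lp_norm_cong_AE) auto
    then show ?case by simp
  next
    case (Suc n)
    let ?E = "Lp_norm p S (\<lambda>t. y (Suc n) t - y n t)"
    have "AE t in lebesgue_on S. \<bar>y (Suc (Suc n)) t - y (Suc n) t\<bar> \<le> K t * ?E"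
      using iterates by eventually_elim (metis A[OF y(1) y(1)])
    then have "Lp_norm p S (\<lambda>t. y (Suc (Suc n)) t - y (Suc n) t) \<le> ?E * N"
      using Lp_le_K[of "\<lambda>t. y (Suc (Suc n)) t - y (Suc n) t" ?E] by (simp add: Lp_norm_nonneg)
    also have "\<dots> \<le> N ^ n * D * N" using Suc.IH N by (intro mult_right_mono) auto
    finally show ?case by (simp add: mult_ac)
  qed
  have limit: "AE t in lebesgue_on S. (\<lambda>n. y n t) \<longlonglongrightarrow> ystar t \<and>
      (\<forall>n. \<bar>ystar t - y (Suc n) t\<bar> \<le> K t * (N ^ n / (1 - N) * D))"
    using iterates
  proof eventually_elim
    case (elim t)
    have "\<bar>y (Suc (Suc n)) t - y (Suc n) t\<bar> \<le> K t * D * N ^ n" for n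
    proof -
      have "\<bar>y (Suc (Suc n)) t - y (Suc n) t\<bar> \<le> K t * Lp_norm p S (\<lambda>t. y (Suc n) t - y n t)"
        using elim A[OF y(1) y(1)] by metis
      also have "\<dots> \<le> K t * (N ^ n * D)"
        using elim K(2) increment_norm by (intro mult_left_mono) auto
      finally show ?thesis by (simp add: mult_ac)
    qed
    note geometric = convergent_geometric_increments[of "\<lambda>n. y (Suc n) t", OF this N]
    have "(\<lambda>n. y (Suc n) t) \<longlonglongrightarrow> lim (\<lambda>n. y (Suc n) t)"
      using geometric(1) by (simp add: convergent_LIMSEQ_iff)
    then have "(\<lambda>n. y n t) \<longlonglongrightarrow> lim (\<lambda>n. y (Suc n) t)"
      by (rule LIMSEQ_imp_Suc)
    moreover from this have "lim (\<lambda>n. y (Suc n) t) = ystar t"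
      unfolding ystar_def by (simp add: limI)
    ultimately show ?case
      using geometric(2) by (simp add: mult_ac)
  qed
  have error_Suc: "in_Lp p S (\<lambda>t. ystar t - y (Suc n) t) \<and>
      Lp_norm p S (\<lambda>t. ystar t - y (Suc n) t) \<le> N ^ Suc n / (1 - N) * D" for n
  proof -
    have "AE t in lebesgue_on S. \<bar>ystar t - y (Suc n) t\<bar> \<le> K t * (N ^ n / (1 - N) * D)"
      using limit by eventually_elim simp
    then show ?thesis
      using Lp_le_K[of "\<lambda>t. ystar t - y (Suc n) t" "N ^ n / (1 - N) * D"] N D
      by (simp add: mult_ac)
  qed
  have Lp_ystar: "in_Lp p S ystar"
    using in_Lp_add[OF p0 conjunct1[OF error_Suc[of 0]] y(1)[of "Suc 0"]] by simp
  have error: "Lp_norm p S (\<lambda>t. ystar t - y n t) \<le> N ^ n / (1 - N) * D" for n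
  proof (cases n)
    case 0
    have "Lp_norm p S (\<lambda>t. ystar t - y 0 t) = Lp_norm p S (\<lambda>t. (ystar t - y (Suc 0) t) + y (Suc 0) t)"
      using y(2) by (intro Lp_norm_cong_AE) auto
    also have "\<dots> \<le> N ^ Suc 0 / (1 - N) * D + D"
      using Minkowski_inequality[OF p conjunct1[OF error_Suc[of 0]] y(1)[of "Suc 0"]]
        conjunct2[OF error_Suc[of 0]] by (simp add: D_def)
    also have "\<dots> = N ^ 0 / (1 - N) * D" using N by (simp add: field_simps)
    finally show ?thesis using 0 by simp
  qed (use error_Suc in simp)
  \<comment> \<open>Both \<open>ystar t\<close> and \<open>A ystar t\<close> are limits of \<open>y (Suc n) t = A (y n) t\<close>.\<close>
  have "AE t in lebesgue_on S. ystar t = A ystar t"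
    using iterates limit
  proof eventually_elim
    case (elim t)
    have "(\<lambda>n. N ^ n / (1 - N) * D) \<longlonglongrightarrow> 0 / (1 - N) * D"
      using N by (intro tendsto_intros LIMSEQ_power_zero) auto
    then have "(\<lambda>n. K t * (N ^ n / (1 - N) * D)) \<longlonglongrightarrow> 0"
      by (intro tendsto_mult_right_zero) simp
    moreover have "\<bar>A (y n) t - A ystar t\<bar> \<le> K t * (N ^ n / (1 - N) * D)" for n
    proof -
      have "\<bar>A ystar t - A (y n) t\<bar> \<le> K t * Lp_norm p S (\<lambda>t. ystar t - y n t)"
        using A Lp_ystar y(1) elim by blast
      also have "\<dots> \<le> K t * (N ^ n / (1 - N) * D)"
        using error K(2) elim by (intro mult_left_mono) auto
      finally show ?thesis by (simp add: abs_minus_commute)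
    qed
    ultimately have "(\<lambda>n. A (y n) t - A ystar t) \<longlonglongrightarrow> 0"
      by (intro Lim_null_comparison[of "\<lambda>n. A (y n) t - A ystar t"]) auto
    then have "(\<lambda>n. y (Suc n) t) \<longlonglongrightarrow> A ystar t"
      using elim by (simp add: LIM_zero_iff)
    moreover have "(\<lambda>n. y (Suc n) t) \<longlonglongrightarrow> ystar t"
      using elim(2) LIMSEQ_Suc by blast
    ultimately show ?case using LIMSEQ_unique by blast
  qed
  moreover have "AE t in lebesgue_on S. z t = ystar t"
    if z: "in_Lp p S z" "AE t in lebesgue_on S. z t = A z t" for z
  proof -
    let ?d = "Lp_norm p S (\<lambda>t. z t - ystar t)"
    have Lp_diff: "in_Lp p S (\<lambda>t. z t - ystar t)" using in_Lp_diff p0 z Lp_ystar by simp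
    have "AE t in lebesgue_on S. \<bar>z t - ystar t\<bar> \<le> K t * ?d"
      using z(2) \<open>AE t in lebesgue_on S. ystar t = A ystar t\<close> AE_S
      by eventually_elim (metis A[OF z(1) Lp_ystar])
    then have "?d \<le> ?d * N"
      using Lp_le_K[of "\<lambda>t. z t - ystar t" ?d] Lp_diff by (simp add: in_Lp_def Lp_norm_nonneg)
    then have "?d * (1 - N) \<le> 0" by (simp add: algebra_simps)
    then have "?d = 0"
      using N Lp_norm_nonneg[of p S "\<lambda>t. z t - ystar t"] by (simp add: mult_le_0_iff)
    from Lp_norm_eq_0_imp_AE_0[OF p0 Lp_diff this] show ?thesis
      by eventually_elim simp
  qed
  ultimately show thesis
    using that[of ystar] Lp_ystar error unfolding N_def D_def by blast
qed

section \<open>The integral operator\<close>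

text \<open>For a function with finite range the claim splits into finitely many pieces with constant
  second argument. Continuity of \<open>\<phi> t\<close> carries it over to pointwise limits of simple functions.\<close>

lemma measurable_superposition:
  fixes \<phi> :: "'a \<Rightarrow> real \<Rightarrow> real"
  assumes meas: "\<And>x. (\<lambda>t. \<phi> t x) \<in> borel_measurable M"
    and cont: "\<And>t. t \<in> space M \<Longrightarrow> continuous_on UNIV (\<phi> t)"
    and u: "u \<in> borel_measurable M"
  shows "(\<lambda>t. \<phi> t (u t)) \<in> borel_measurable M"
proof -
  obtain w where w: "\<And>i. simple_function M (w i)"
    and lim: "\<And>t. t \<in> space M \<Longrightarrow> (\<lambda>i. w i t) \<longlonglongrightarrow> u t"
    using borel_measurable_implies_sequence_metric[OF u, of 0] by blast
  show ?thesis
  proof (rule borel_measurable_LIMSEQ_metric)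
    fix i
    have "w i \<in> measurable M (count_space (w i ` space M))"
      using w[of i] measurable_simple_function by (auto simp: measurable_count_space_eq2 simple_function_def)
    moreover have "countable (w i ` space M)"
      using w[of i] by (simp add: simple_function_def countable_finite)
    ultimately show "(\<lambda>t. \<phi> t (w i t)) \<in> borel_measurable M"
      using meas measurable_compose_countable'[of "w i ` space M" "\<lambda>x t. \<phi> t x" M borel "w i"]
      by simp
  next
    fix t assume t: "t \<in> space M"
    show "(\<lambda>i. \<phi> t (w i t)) \<longlonglongrightarrow> \<phi> t (u t)"
      by (rule continuous_on_tendsto_compose[OF cont[OF t] lim[OF t]]) auto
  qed
qed

lemma conjugate_exponent_gt_1:
  fixes p q :: real
  assumes "1 < p" "1 / p + 1 / q = 1"
  shows "1 < q"
proof -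
  have "0 < 1 / p" "1 / p < 1" using assms(1) by auto
  then have "0 < 1 / q" "1 / q < 1" using assms(2) by linarith+
  then show ?thesis by (simp add: divide_less_eq_1)
qed

lemma caratheodory_superposition_in_Lp:
  assumes g: "caratheodory a b g" "\<forall>s\<in>{a..b}. \<forall>z. g s z \<in> {a..b}" and p: "0 < p"
    and u: "u \<in> borel_measurable (lebesgue_on {a..b})"
  shows "in_Lp p {a..b} (\<lambda>s. g s (u s))"
    and "Lp_norm p {a..b} (\<lambda>s. g s (u s)) \<le> Lp_norm p {a..b} (\<lambda>s. \<bar>a\<bar> + \<bar>b\<bar>)"
proof -
  have meas: "(\<lambda>s. g s (u s)) \<in> borel_measurable (lebesgue_on {a..b})"
    by (rule measurable_superposition[of g, OF _ _ u]) (use g(1) in \<open>auto simp: caratheodory_def\<close>)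
  have const: "in_Lp p {a..b} (\<lambda>s. \<bar>a\<bar> + \<bar>b\<bar>)"
    by (rule in_Lp_const) simp
  have bound: "AE s in lebesgue_on {a..b}. \<bar>g s (u s)\<bar> \<le> \<bar>\<bar>a\<bar> + \<bar>b\<bar>\<bar>"
  proof (rule AE_I2)
    fix s assume "s \<in> space (lebesgue_on {a..b})"
    then have "g s (u s) \<in> {a..b}" using g(2) by simp
    then show "\<bar>g s (u s)\<bar> \<le> \<bar>\<bar>a\<bar> + \<bar>b\<bar>\<bar>" by auto
  qed
  show "in_Lp p {a..b} (\<lambda>s. g s (u s))"
    using in_Lp_dominated[OF _ const meas bound] p by simp
  show "Lp_norm p {a..b} (\<lambda>s. g s (u s)) \<le> Lp_norm p {a..b} (\<lambda>s. \<bar>a\<bar> + \<bar>b\<bar>)"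
    using Lp_norm_mono_AE[OF p const meas bound] .
qed

lemma abs_integral_mult_le_Lp_norms:
  assumes "1 < p" "1 < q" "1 / p + 1 / q = 1" "in_Lp p S u" "in_Lp q S v"
  shows "\<bar>LINT t|lebesgue_on S. u t * v t\<bar> \<le> Lp_norm p S u * Lp_norm q S v"
  using Holder_inequality[OF assms] integral_abs_bound[of "lebesgue_on S" "\<lambda>t. u t * v t"]
  by linarith

text \<open>Since \<open>g\<close> is bounded, \<open>y\<close> enters only through a uniformly bounded function, so the image
  has an \<open>L\<^sup>p\<close> bound that does not depend on \<open>y\<close>.\<close>

lemma integral_op_bound:
  assumes pq: "1 < p" "1 / p + 1 / q = 1"
    and k: "in_Lp q {a..b} (k t)" "Lp_norm q {a..b} (k t) \<le> M1 t"
    and g: "caratheodory a b g" "\<forall>s\<in>{a..b}. \<forall>z. g s z \<in> {a..b}"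
    and f: "0 \<le> M" "\<And>x1 x2. \<bar>f t x1 - f t x2\<bar> \<le> M * \<bar>x1 - x2\<bar>"
    and u: "u \<in> borel_measurable (lebesgue_on {a..b})"
  shows "\<bar>integral_op a b f k g u t\<bar>
    \<le> \<bar>f t 0\<bar> + M * Lp_norm p {a..b} (\<lambda>s. \<bar>a\<bar> + \<bar>b\<bar>) * M1 t"
proof -
  let ?J = "LINT s|lebesgue_on {a..b}. k t s * g s (u s)"
  have q: "1 < q" "1 / q + 1 / p = 1" using conjugate_exponent_gt_1[OF pq] pq by auto
  have G: "in_Lp p {a..b} (\<lambda>s. g s (u s))"
      "Lp_norm p {a..b} (\<lambda>s. g s (u s)) \<le> Lp_norm p {a..b} (\<lambda>s. \<bar>a\<bar> + \<bar>b\<bar>)"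
    using caratheodory_superposition_in_Lp[OF g _ u, of p] pq by auto
  have "\<bar>?J\<bar> \<le> Lp_norm q {a..b} (k t) * Lp_norm p {a..b} (\<lambda>s. g s (u s))"
    by (rule abs_integral_mult_le_Lp_norms[OF q(1) pq(1) q(2) k(1) G(1)])
  also have "\<dots> \<le> M1 t * Lp_norm p {a..b} (\<lambda>s. \<bar>a\<bar> + \<bar>b\<bar>)"
    using order_trans[OF Lp_norm_nonneg k(2)] by (intro mult_mono k(2) G(2) Lp_norm_nonneg)
  finally have "M * \<bar>?J\<bar> \<le> M * (M1 t * Lp_norm p {a..b} (\<lambda>s. \<bar>a\<bar> + \<bar>b\<bar>))"
    using f(1) by (intro mult_left_mono)
  moreover have "\<bar>f t ?J - f t 0\<bar> \<le> M * \<bar>?J\<bar>"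
    using f(2)[of ?J 0] by simp
  ultimately show ?thesis
    unfolding integral_op_def by (simp add: mult_ac)
qed

text \<open>The constant \<open>M * L * M1 t\<close> collects the Lipschitz constant of \<open>f\<close>, that of \<open>g\<close>, and the
  \<open>L\<^sup>q\<close> norm of the kernel from Hoelder's inequality. The two integrals must exist separately
  before their difference can be estimated; they do because \<open>g\<close> is bounded.\<close>

lemma integral_op_Lipschitz:
  assumes pq: "1 < p" "1 / p + 1 / q = 1"
    and k: "in_Lp q {a..b} (k t)" "Lp_norm q {a..b} (k t) \<le> M1 t"
    and g: "caratheodory a b g" "\<forall>s\<in>{a..b}. \<forall>z. g s z \<in> {a..b}"
      "0 \<le> L" "\<forall>s\<in>{a..b}. \<forall>z1 z2. \<bar>g s z1 - g s z2\<bar> \<le> L * \<bar>z1 - z2\<bar>"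
    and f: "0 \<le> M" "\<And>x1 x2. \<bar>f t x1 - f t x2\<bar> \<le> M * \<bar>x1 - x2\<bar>"
    and u: "in_Lp p {a..b} u" and v: "in_Lp p {a..b} v"
  shows "\<bar>integral_op a b f k g u t - integral_op a b f k g v t\<bar>
    \<le> M * L * M1 t * Lp_norm p {a..b} (\<lambda>s. u s - v s)"
proof -
  let ?J = "\<lambda>w. LINT s|lebesgue_on {a..b}. k t s * g s (w s)"
  let ?d = "\<lambda>s. g s (u s) - g s (v s)"
  have p0: "0 < p" using pq by simp
  have q: "1 < q" "1 / q + 1 / p = 1" using conjugate_exponent_gt_1[OF pq] pq by auto
  have G: "in_Lp p {a..b} (\<lambda>s. g s (w s))" if "in_Lp p {a..b} w" for w
    using caratheodory_superposition_in_Lp(1)[OF g(1,2) p0] that by (simp add: in_Lp_def)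
  have kG: "integrable (lebesgue_on {a..b}) (\<lambda>s. k t s * g s (w s))" if "in_Lp p {a..b} w" for w
    by (rule Holder_inequality(1)[OF q(1) pq(1) q(2) k(1) G[OF that]])
  have Lp_d: "in_Lp p {a..b} ?d"
    by (rule in_Lp_diff[OF p0 G[OF u] G[OF v]])
  have "Lp_norm p {a..b} ?d \<le> Lp_norm p {a..b} (\<lambda>s. L * (u s - v s))"
  proof (rule Lp_norm_mono_AE[OF p0])
    show "in_Lp p {a..b} (\<lambda>s. L * (u s - v s))"
      by (intro in_Lp_cmult in_Lp_diff p0 u v)
    show "?d \<in> borel_measurable (lebesgue_on {a..b})"
      using Lp_d by (simp add: in_Lp_def)
    show "AE s in lebesgue_on {a..b}. \<bar>?d s\<bar> \<le> \<bar>L * (u s - v s)\<bar>"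
      using g(3,4) by (intro AE_I2) (simp add: abs_mult)
  qed
  also have "\<dots> = L * Lp_norm p {a..b} (\<lambda>s. u s - v s)"
    using g(3) Lp_norm_cmult[OF p0] by simp
  finally have d_le: "Lp_norm p {a..b} ?d \<le> L * Lp_norm p {a..b} (\<lambda>s. u s - v s)" .
  have "?J u - ?J v = (LINT s|lebesgue_on {a..b}. k t s * ?d s)"
    using kG[OF u] kG[OF v] by (simp add: right_diff_distrib)
  then have "\<bar>?J u - ?J v\<bar> \<le> Lp_norm q {a..b} (k t) * Lp_norm p {a..b} ?d"
    using abs_integral_mult_le_Lp_norms[OF q(1) pq(1) q(2) k(1) Lp_d] by simp
  also have "\<dots> \<le> M1 t * (L * Lp_norm p {a..b} (\<lambda>s. u s - v s))"
    using order_trans[OF Lp_norm_nonneg k(2)] by (intro mult_mono k(2) d_le Lp_norm_nonneg)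
  finally have "M * \<bar>?J u - ?J v\<bar> \<le> M * (M1 t * (L * Lp_norm p {a..b} (\<lambda>s. u s - v s)))"
    using f(1) by (intro mult_left_mono)
  also have "\<dots> = M * L * M1 t * Lp_norm p {a..b} (\<lambda>s. u s - v s)"
    by (simp only: mult_ac)
  finally show ?thesis
    unfolding integral_op_def by (rule order_trans[OF f(2)])
qed

section \<open>Convergence of the successive approximations\<close>

theorem theorem3p1:
  fixes a b p q b1 b0 M L C N :: real
    and f k g :: "real \<Rightarrow> real \<Rightarrow> real"
    and h1 M1 a0 :: "real \<Rightarrow> real"
    and y :: "nat \<Rightarrow> real \<Rightarrow> real"
  assumes "a < b" and "1 < p" and "1 / p + 1 / q = 1"
    and f_car: "caratheodory a b f"
    and A1: "in_Lp p {a..b} h1" "\<forall>t\<in>{a..b}. 0 \<le> h1 t" "0 \<le> b1"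
      "AE t in lebesgue_on {a..b}. \<forall>x. \<bar>f t x\<bar> \<le> h1 t + b1 * \<bar>x\<bar> powr (q / p)"
    and A2: "\<forall>t\<in>{a..b}. in_Lp q {a..b} (\<lambda>s. k t s)"
      "in_Lp p {a..b} M1" "\<forall>t\<in>{a..b}. 0 \<le> M1 t"
      "\<forall>t\<in>{a..b}. Lp_norm q {a..b} (\<lambda>s. k t s) \<le> M1 t"
    and A3: "\<forall>s\<in>{a..b}. \<forall>z. g s z \<in> {a..b}" "caratheodory a b g"
      "in_Lp p {a..b} a0" "\<forall>s\<in>{a..b}. 0 \<le> a0 s" "0 \<le> b0"
      "\<forall>s\<in>{a..b}. \<forall>z. \<bar>g s z\<bar> \<le> a0 s + b0 * \<bar>z\<bar>"
    and H1: "0 < M" "\<forall>t\<in>{a..b}. \<forall>x1 x2. \<bar>f t x1 - f t x2\<bar> \<le> M * \<bar>x1 - x2\<bar>"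
    and H2: "0 < L" "\<forall>s\<in>{a..b}. \<forall>z1 z2. \<bar>g s z1 - g s z2\<bar> \<le> L * \<bar>z1 - z2\<bar>"
    and C: "C = M * L"
    and N: "N = (LINT s|lebesgue_on {a..b}. C powr p * M1 s powr p) powr (1 / p)" "N < 1"
    and y: "successive_approximations a b f k g y"
  shows "(\<forall>n. in_Lp p {a..b} (y n)) \<and>
    (\<exists>ystar. Lp_solution p a b f k g ystar \<and>
      (\<forall>z. Lp_solution p a b f k g z \<longrightarrow> (AE t in lebesgue_on {a..b}. z t = ystar t)) \<and>
      (\<forall>n. Lp_norm p {a..b} (\<lambda>t. ystar t - y n t) \<le> N ^ n / (1 - N) * Lp_norm p {a..b} (y 1)))"
proof -
  let ?S = "{a..b}"
  let ?A = "integral_op a b f k g"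
  let ?K = "\<lambda>t. C * M1 t"
  have p: "0 < p" "1 \<le> p" using \<open>1 < p\<close> by auto
  have C0: "0 \<le> C" using C H1(1) H2(1) by simp
  have meas: "y n \<in> borel_measurable (lebesgue_on ?S)" for n
    using y by (simp add: successive_approximations_def)
  have y0: "AE t in lebesgue_on ?S. y 0 t = 0"
    and ySuc: "\<And>n. AE t in lebesgue_on ?S. y (Suc n) t = ?A (y n) t"
    using y by (simp_all add: successive_approximations_def)
  have Lp_y: "in_Lp p ?S (y n)" for n
  proof (cases n)
    case 0
    have "in_Lp p ?S (\<lambda>t. 0)" by (rule in_Lp_const) simp
    moreover have "AE t in lebesgue_on ?S. \<bar>y 0 t\<bar> \<le> \<bar>0\<bar>"
      using y0 by eventually_elim simp
    ultimately show ?thesis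
      using in_Lp_dominated[of p ?S "\<lambda>t. 0" "y 0"] p meas 0 by simp
  next
    case (Suc m)
    let ?G = "Lp_norm p ?S (\<lambda>s. \<bar>a\<bar> + \<bar>b\<bar>)"
    have "in_Lp p ?S (\<lambda>t. h1 t + M * ?G * M1 t)"
      by (intro in_Lp_add in_Lp_cmult p A1(1) A2(2))
    moreover have "AE t in lebesgue_on ?S. \<bar>y (Suc m) t\<bar> \<le> \<bar>h1 t + M * ?G * M1 t\<bar>"
    proof -
      have "AE t in lebesgue_on ?S. t \<in> ?S" by (intro AE_I2) simp
      with ySuc[of m] A1(4) show ?thesis
      proof eventually_elim
        case (elim t)
        have "\<bar>?A (y m) t\<bar> \<le> \<bar>f t 0\<bar> + M * ?G * M1 t"
          by (rule integral_op_bound[where k = k and t = t and f = f and M = M and ?M1.0 = M1,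
                OF \<open>1 < p\<close> \<open>1 / p + 1 / q = 1\<close> _ _ A3(2,1) _ _ meas])
            (use elim(3) A2(1,4) H1 in auto)
        moreover have "\<bar>f t 0\<bar> \<le> h1 t" using elim(2)[rule_format, of 0] by simp
        ultimately show ?case using elim(1) by linarith
      qed
    qed
    ultimately show ?thesis
      using in_Lp_dominated p meas Suc by (metis less_imp_le)
  qed
  have N_norm: "Lp_norm p ?S ?K = N"
  proof -
    have "(LINT t|lebesgue_on ?S. \<bar>?K t\<bar> powr p) = (LINT s|lebesgue_on ?S. C powr p * M1 s powr p)"
      using C0 A2(3) by (intro Bochner_Integration.integral_cong) (auto simp: abs_mult powr_mult)
    then show ?thesis by (simp add: Lp_norm_def N(1))
  qed
  obtain ystar where "in_Lp p ?S ystar" "AE t in lebesgue_on ?S. ystar t = ?A ystar t"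
    and "\<And>z. in_Lp p ?S z \<Longrightarrow> AE t in lebesgue_on ?S. z t = ?A z t \<Longrightarrow>
      AE t in lebesgue_on ?S. z t = ystar t"
    and "\<And>n. Lp_norm p ?S (\<lambda>t. ystar t - y n t) \<le> N ^ n / (1 - N) * Lp_norm p ?S (y 1)"
  proof (rule pointwise_contraction_fixed_point[where A = ?A and K = ?K, OF p(2) _ _ _ _ Lp_y y0 ySuc])
    show "in_Lp p ?S ?K" by (rule in_Lp_cmult[OF A2(2)])
    show "0 \<le> ?K t" if "t \<in> ?S" for t using that C0 A2(3) by simp
    show "Lp_norm p ?S ?K < 1" using N_norm N(2) by simp
    show "\<bar>?A u t - ?A v t\<bar> \<le> ?K t * Lp_norm p ?S (\<lambda>s. u s - v s)"
      if "in_Lp p ?S u" "in_Lp p ?S v" "t \<in> ?S" for u v t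
      unfolding C
      by (rule integral_op_Lipschitz[where k = k and t = t and f = f and M = M and ?M1.0 = M1,
            OF \<open>1 < p\<close> \<open>1 / p + 1 / q = 1\<close> _ _ A3(2,1) _ _ _ _ that(1,2)])
        (use that(3) A2(1,4) H1 H2 in auto)
  qed (simp_all only: N_norm)
  then show ?thesis
    using Lp_y unfolding Lp_solution_def by blast
qed

end
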